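(* Let $P:\mathbb C^{\mathrm{op}}\to\mathbf{Pos}$ be a primary doctrine, $X$ an object of $\mathbb C$ and $\varphi\in P(X)$, and let $P_{(X,\varphi)}$ be the associated Kleisli doctrine. If $P$ has weak power objects, then $P_{(X,\varphi)}$ has weak power objects.
   Context: A doctrine is a functor $P:\mathbb C^{\mathrm{op}}\to\mathbf{Pos}$ with $\mathbb C$ a category with finite products and $\mathbf{Pos}$ the category of posets and monotone maps; the maps $P(f)$ are called reindexings. It is primary if every $P(A)$ has finite meets ($\wedge$, $\top$) and all reindexings preserve them. A doctrine $P:\mathbb C^{\mathrm{op}}\to\mathbf{Pos}$ has weak power objects if for every object $A$ of $\mathbb C$ there exist an object $\mathsf P(A)$ and an element $\in_A\;\in P(A\times\mathsf P(A))$ such that for every object $B$ and every $\phi\in P(A\times B)$ there exists an arrow $\{\phi\}:B\to\mathsf P(A)$ with $\phi=P(\mathrm{id}_A\times\{\phi\})(\in_A)$. Kleisli doctrine (the Kleisli object of the comonad on $P$ given by $X\times-$ and $\alpha\mapsto P(\mathrm{pr}_1)(\varphi)\wedge P(\mathrm{pr}_2)(\alpha)$). The category $\mathbb C_X$ has the same objects as $\mathbb C$; an arrow $g:A\rightsquigarrow B$ in $\mathbb C_X$ is a $\mathbb C$-arrow $g:X\times A\to B$; the identity of $A$ is $\mathrm{pr}_2:X\times A\to A$; the composite of $g:A\rightsquigarrow B$ and $h:B\rightsquigarrow C$ is $h\langle\mathrm{pr}_1,g\rangle$. It has finite products, given on objects by those of $\mathbb C$. The doctrine $P_{(X,\varphi)}:\mathbb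 C_X^{\mathrm{op}}\to\mathbf{Pos}$ has $P_{(X,\varphi)}(A)=\{\alpha\in P(X\times A)\mid\alpha\le P(\mathrm{pr}_1)(\varphi)\}$ with the order of $P(X\times A)$, and reindexing along $g:A\rightsquigarrow B$ is the restriction of $P(\langle\mathrm{pr}_1,g\rangle)$. *)

theory Defs
  imports "HOL-Algebra.Lattice"
begin

text \<open>Hom-sets are indexed by source and target and are not required to be disjoint, so composition
  carries its three objects: \<open>Comp C A B D g f\<close> is the composite of \<open>f : A \<rightarrow> B\<close> and \<open>g : B \<rightarrow> D\<close>.
  In this way an arrow \<open>A \<leadsto> B\<close> of the Kleisli category can literally be an arrow \<open>X \<times> A \<rightarrow> B\<close>,
  although \<open>A\<close> need not be determined by the object \<open>X \<times> A\<close>.\<close>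

record ('o, 'a) category =
  Obj :: "'o set"
  Hom :: "'o \<Rightarrow> 'o \<Rightarrow> 'a set"
  Id :: "'o \<Rightarrow> 'a"
  Comp :: "'o \<Rightarrow> 'o \<Rightarrow> 'o \<Rightarrow> 'a \<Rightarrow> 'a \<Rightarrow> 'a"

locale category =
  fixes C (structure)
  assumes Id_in_Hom: "A \<in> Obj C \<Longrightarrow> Id C A \<in> Hom C A A"
    and Comp_in_Hom:
      "\<lbrakk>A \<in> Obj C; B \<in> Obj C; D \<in> Obj C; f \<in> Hom C A B; g \<in> Hom C B D\<rbrakk>
        \<Longrightarrow> Comp C A B D g f \<in> Hom C A D"
    and Comp_Id_right: "\<lbrakk>A \<in> Obj C; B \<in> Obj C; f \<in> Hom C A B\<rbrakk> \<Longrightarrow> Comp C A A B f (Id C A) = f"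
    and Comp_Id_left: "\<lbrakk>A \<in> Obj C; B \<in> Obj C; f \<in> Hom C A B\<rbrakk> \<Longrightarrow> Comp C A B B (Id C B) f = f"
    and Comp_assoc:
      "\<lbrakk>A \<in> Obj C; B \<in> Obj C; D \<in> Obj C; E \<in> Obj C; f \<in> Hom C A B; g \<in> Hom C B D; h \<in> Hom C D E\<rbrakk>
        \<Longrightarrow> Comp C A D E h (Comp C A B D g f) = Comp C A B E (Comp C B D E h g) f"

record ('o, 'a) fp_category = "('o, 'a) category" +
  Terminal :: 'o
  Prod :: "'o \<Rightarrow> 'o \<Rightarrow> 'o" (infixr "\<boxtimes>\<index>" 70)
  Pr1 :: "'o \<Rightarrow> 'o \<Rightarrow> 'a"
  Pr2 :: "'o \<Rightarrow> 'o \<Rightarrow> 'a"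

locale fp_category = category C for C (structure) +
  assumes Terminal_in_Obj: "Terminal C \<in> Obj C"
    and Terminal_ex1: "A \<in> Obj C \<Longrightarrow> \<exists>!f. f \<in> Hom C A (Terminal C)"
    and Prod_in_Obj: "\<lbrakk>A \<in> Obj C; B \<in> Obj C\<rbrakk> \<Longrightarrow> A \<boxtimes> B \<in> Obj C"
    and Pr1_in_Hom: "\<lbrakk>A \<in> Obj C; B \<in> Obj C\<rbrakk> \<Longrightarrow> Pr1 C A B \<in> Hom C (A \<boxtimes> B) A"
    and Pr2_in_Hom: "\<lbrakk>A \<in> Obj C; B \<in> Obj C\<rbrakk> \<Longrightarrow> Pr2 C A B \<in> Hom C (A \<boxtimes> B) B"
    and Pairing_ex1:
      "\<lbrakk>D \<in> Obj C; A \<in> Obj C; B \<in> Obj C; f \<in> Hom C D A; g \<in> Hom C D B\<rbrakk> \<Longrightarrow>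
        \<exists>!h. h \<in> Hom C D (A \<boxtimes> B) \<and> Comp C D (A \<boxtimes> B) A (Pr1 C A B) h = f
              \<and> Comp C D (A \<boxtimes> B) B (Pr2 C A B) h = g"

text \<open>\<open>Pairing C D A B f g\<close> is \<open>\<langle>f, g\<rangle> : D \<rightarrow> A \<times> B\<close> and \<open>Prod_map C A A' B B' f g\<close> is
  \<open>f \<times> g : A \<times> B \<rightarrow> A' \<times> B'\<close>.\<close>

definition Pairing :: "('o, 'a, 'm) fp_category_scheme \<Rightarrow> 'o \<Rightarrow> 'o \<Rightarrow> 'o \<Rightarrow> 'a \<Rightarrow> 'a \<Rightarrow> 'a" where
  "Pairing C D A B f g =
    (THE h. h \<in> Hom C D (A \<boxtimes>\<^bsub>C\<^esub> B) \<and> Comp C D (A \<boxtimes>\<^bsub>C\<^esub> B) A (Pr1 C A B) h = f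
            \<and> Comp C D (A \<boxtimes>\<^bsub>C\<^esub> B) B (Pr2 C A B) h = g)"

definition Prod_map ::
  "('o, 'a, 'm) fp_category_scheme \<Rightarrow> 'o \<Rightarrow> 'o \<Rightarrow> 'o \<Rightarrow> 'o \<Rightarrow> 'a \<Rightarrow> 'a \<Rightarrow> 'a" where
  "Prod_map C A A' B B' f g =
    Pairing C (A \<boxtimes>\<^bsub>C\<^esub> B) A' B'
      (Comp C (A \<boxtimes>\<^bsub>C\<^esub> B) A A' f (Pr1 C A B)) (Comp C (A \<boxtimes>\<^bsub>C\<^esub> B) B B' g (Pr2 C A B))"

text \<open>For \<open>f : A \<rightarrow> B\<close>, \<open>Reindex P A B f\<close> is the monotone map \<open>P(f)\<close> from \<open>P(B) = Fib P B\<close> to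
  \<open>P(A) = Fib P A\<close>; only its values on the carrier of \<open>Fib P B\<close> are meaningful.\<close>

record ('o, 'a, 'p) doctrine = "('o, 'a) fp_category" +
  Fib :: "'o \<Rightarrow> 'p gorder"
  Reindex :: "'o \<Rightarrow> 'o \<Rightarrow> 'a \<Rightarrow> 'p \<Rightarrow> 'p"

locale doctrine = fp_category P for P (structure) +
  assumes Fib_partial_order: "A \<in> Obj P \<Longrightarrow> partial_order (Fib P A)"
    and Reindex_closed:
      "\<lbrakk>A \<in> Obj P; B \<in> Obj P; f \<in> Hom P A B\<rbrakk>
        \<Longrightarrow> Reindex P A B f \<in> carrier (Fib P B) \<rightarrow> carrier (Fib P A)"
    and Reindex_isotone:
      "\<lbrakk>A \<in> Obj P; B \<in> Obj P; f \<in> Hom P A B\<rbrakk> \<Longrightarrow> isotone (Fib P B) (Fib P A) (Reindex P A B f)"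
    and Reindex_Id:
      "\<lbrakk>A \<in> Obj P; \<alpha> \<in> carrier (Fib P A)\<rbrakk> \<Longrightarrow> Reindex P A A (Id P A) \<alpha> = \<alpha>"
    and Reindex_Comp:
      "\<lbrakk>A \<in> Obj P; B \<in> Obj P; D \<in> Obj P; f \<in> Hom P A B; g \<in> Hom P B D; \<alpha> \<in> carrier (Fib P D)\<rbrakk>
        \<Longrightarrow> Reindex P A D (Comp P A B D g f) \<alpha> = Reindex P A B f (Reindex P B D g \<alpha>)"

locale primary_doctrine = doctrine P for P (structure) +
  assumes Fib_meet: "A \<in> Obj P \<Longrightarrow> lower_semilattice (Fib P A)"
    and Fib_top: "A \<in> Obj P \<Longrightarrow> weak_partial_order_top (Fib P A)"
    and Reindex_meet:
      "\<lbrakk>A \<in> Obj P; B \<in> Obj P; f \<in> Hom P A B; \<alpha> \<in> carrier (Fib P B); \<beta> \<in> carrier (Fib P B)\<rbrakk>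
        \<Longrightarrow> Reindex P A B f (\<alpha> \<sqinter>\<^bsub>Fib P B\<^esub> \<beta>)
              = Reindex P A B f \<alpha> \<sqinter>\<^bsub>Fib P A\<^esub> Reindex P A B f \<beta>"
    and Reindex_top:
      "\<lbrakk>A \<in> Obj P; B \<in> Obj P; f \<in> Hom P A B\<rbrakk>
        \<Longrightarrow> Reindex P A B f \<top>\<^bsub>Fib P B\<^esub> = \<top>\<^bsub>Fib P A\<^esub>"

definition has_weak_power_objects :: "('o, 'a, 'p, 'm) doctrine_scheme \<Rightarrow> bool" where
  "has_weak_power_objects P \<longleftrightarrow>
    (\<forall>A \<in> Obj P. \<exists>PA \<in> Obj P. \<exists>mem \<in> carrier (Fib P (A \<boxtimes>\<^bsub>P\<^esub> PA)).
      \<forall>B \<in> Obj P. \<forall>\<phi> \<in> carrier (Fib P (A \<boxtimes>\<^bsub>P\<^esub> B)). \<exists>f \<in> Hom P B PA.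
        \<phi> = Reindex P (A \<boxtimes>\<^bsub>P\<^esub> B) (A \<boxtimes>\<^bsub>P\<^esub> PA) (Prod_map P A A B PA (Id P A) f) mem)"

definition kleisli_doctrine :: "('o, 'a, 'p) doctrine \<Rightarrow> 'o \<Rightarrow> 'p \<Rightarrow> ('o, 'a, 'p) doctrine" where
  "kleisli_doctrine P X \<phi> =
    \<lparr> Obj = Obj P,
      Hom = (\<lambda>A B. Hom P (X \<boxtimes>\<^bsub>P\<^esub> A) B),
      Id = (\<lambda>A. Pr2 P X A),
      Comp = (\<lambda>A B D h g.
        Comp P (X \<boxtimes>\<^bsub>P\<^esub> A) (X \<boxtimes>\<^bsub>P\<^esub> B) D h (Pairing P (X \<boxtimes>\<^bsub>P\<^esub> A) X B (Pr1 P X A) g)),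
      Terminal = Terminal P,
      Prod = Prod P,
      Pr1 = (\<lambda>A B. Comp P (X \<boxtimes>\<^bsub>P\<^esub> (A \<boxtimes>\<^bsub>P\<^esub> B)) (A \<boxtimes>\<^bsub>P\<^esub> B) A (Pr1 P A B) (Pr2 P X (A \<boxtimes>\<^bsub>P\<^esub> B))),
      Pr2 = (\<lambda>A B. Comp P (X \<boxtimes>\<^bsub>P\<^esub> (A \<boxtimes>\<^bsub>P\<^esub> B)) (A \<boxtimes>\<^bsub>P\<^esub> B) B (Pr2 P A B) (Pr2 P X (A \<boxtimes>\<^bsub>P\<^esub> B))),
      Fib = (\<lambda>A. (Fib P (X \<boxtimes>\<^bsub>P\<^esub> A))
        \<lparr> carrier := {\<alpha> \<in> carrier (Fib P (X \<boxtimes>\<^bsub>P\<^esub> A)).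
                       \<alpha> \<sqsubseteq>\<^bsub>Fib P (X \<boxtimes>\<^bsub>P\<^esub> A)\<^esub> Reindex P (X \<boxtimes>\<^bsub>P\<^esub> A) X (Pr1 P X A) \<phi>} \<rparr>),
      Reindex = (\<lambda>A B g.
        Reindex P (X \<boxtimes>\<^bsub>P\<^esub> A) (X \<boxtimes>\<^bsub>P\<^esub> B) (Pairing P (X \<boxtimes>\<^bsub>P\<^esub> A) X B (Pr1 P X A) g)) \<rparr>"

context fp_category
begin

lemma Pairing_props:
  assumes "D \<in> Obj C" "A \<in> Obj C" "B \<in> Obj C" "f \<in> Hom C D A" "g \<in> Hom C D B"
  shows "Pairing C D A B f g \<in> Hom C D (A \<boxtimes> B)"
    and "Comp C D (A \<boxtimes> B) A (Pr1 C A B) (Pairing C D A B f g) = f"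
    and "Comp C D (A \<boxtimes> B) B (Pr2 C A B) (Pairing C D A B f g) = g"
  using theI'[OF Pairing_ex1[OF assms]] unfolding Pairing_def by blast+

lemma Pairing_unique:
  assumes "D \<in> Obj C" "A \<in> Obj C" "B \<in> Obj C" "h \<in> Hom C D (A \<boxtimes> B)"
    and "Comp C D (A \<boxtimes> B) A (Pr1 C A B) h = f" "Comp C D (A \<boxtimes> B) B (Pr2 C A B) h = g"
  shows "h = Pairing C D A B f g"
proof -
  have f: "f \<in> Hom C D A" and g: "g \<in> Hom C D B"
    using Comp_in_Hom[OF assms(1) Prod_in_Obj[OF assms(2,3)] assms(2,4) Pr1_in_Hom]
      Comp_in_Hom[OF assms(1) Prod_in_Obj[OF assms(2,3)] assms(3,4) Pr2_in_Hom] assms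
    by simp_all
  show ?thesis
    using Pairing_ex1[OF assms(1-3) f g] Pairing_props[OF assms(1-3) f g] assms by blast
qed

lemma Pairing_Comp:
  assumes "E \<in> Obj C" "D \<in> Obj C" "A \<in> Obj C" "B \<in> Obj C"
    and "f \<in> Hom C D A" "g \<in> Hom C D B" "k \<in> Hom C E D"
  shows "Comp C E D (A \<boxtimes> B) (Pairing C D A B f g) k
          = Pairing C E A B (Comp C E D A f k) (Comp C E D B g k)"
  using assms
  by (intro Pairing_unique)
    (simp_all add: Comp_in_Hom Prod_in_Obj Pr1_in_Hom Pr2_in_Hom Pairing_props Comp_assoc)

lemma Pairing_Pr:
  assumes "A \<in> Obj C" "B \<in> Obj C"
  shows "Pairing C (A \<boxtimes> B) A B (Pr1 C A B) (Pr2 C A B) = Id C (A \<boxtimes> B)"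
  using assms
  by (intro Pairing_unique[symmetric])
    (simp_all add: Id_in_Hom Prod_in_Obj Pr1_in_Hom Pr2_in_Hom Comp_Id_right)

end

lemma kleisli_category:
  fixes P :: "('o, 'a, 'p) doctrine"
  assumes "doctrine P" and X: "X \<in> Obj P"
  shows "category (kleisli_doctrine P X \<phi>)"
proof -
  interpret doctrine P by fact
  show ?thesis
  proof (unfold_locales, goal_cases)
    case (5 A B D E f g h)
    then show ?case
      using X by (simp add: kleisli_doctrine_def Prod_in_Obj Pr1_in_Hom Pairing_props Pairing_Comp
          flip: Comp_assoc)
  qed (use X in \<open>simp_all add: kleisli_doctrine_def Prod_in_Obj Pr1_in_Hom Pr2_in_Hom
        Comp_in_Hom Pairing_props Pairing_Pr Comp_Id_right\<close>)
qed

lemma kleisli_fp_category: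
  fixes P :: "('o, 'a, 'p) doctrine"
  assumes "doctrine P" and X: "X \<in> Obj P"
  shows "fp_category (kleisli_doctrine P X \<phi>)"
proof -
  interpret doctrine P by fact
  let ?K = "kleisli_doctrine P X \<phi>"
  interpret K: category ?K
    by (rule kleisli_category) (use assms in auto)
  have comp_Pr: "Comp ?K D (A \<boxtimes>\<^bsub>P\<^esub> B) A (Pr1 ?K A B) h = Comp P (X \<boxtimes>\<^bsub>P\<^esub> D) (A \<boxtimes>\<^bsub>P\<^esub> B) A (Pr1 P A B) h"
      "Comp ?K D (A \<boxtimes>\<^bsub>P\<^esub> B) B (Pr2 ?K A B) h = Comp P (X \<boxtimes>\<^bsub>P\<^esub> D) (A \<boxtimes>\<^bsub>P\<^esub> B) B (Pr2 P A B) h"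
    if "D \<in> Obj P" "A \<in> Obj P" "B \<in> Obj P" "h \<in> Hom P (X \<boxtimes>\<^bsub>P\<^esub> D) (A \<boxtimes>\<^bsub>P\<^esub> B)" for D A B h
    using X that
    by (simp_all add: kleisli_doctrine_def Prod_in_Obj Pr1_in_Hom Pr2_in_Hom Pairing_props
        flip: Comp_assoc)
  have simps: "Obj ?K = Obj P" "Prod ?K = Prod P" "\<And>A B. Hom ?K A B = Hom P (X \<boxtimes>\<^bsub>P\<^esub> A) B"
      "Terminal ?K = Terminal P"
    by (simp_all add: kleisli_doctrine_def)
  show ?thesis
  proof
    fix D A B f g
    assume *: "D \<in> Obj ?K" "A \<in> Obj ?K" "B \<in> Obj ?K" "f \<in> Hom ?K D A" "g \<in> Hom ?K D B"
    then have "\<exists>!h. h \<in> Hom P (X \<boxtimes>\<^bsub>P\<^esub> D) (A \<boxtimes>\<^bsub>P\<^esub> B)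
        \<and> Comp P (X \<boxtimes>\<^bsub>P\<^esub> D) (A \<boxtimes>\<^bsub>P\<^esub> B) A (Pr1 P A B) h = f
        \<and> Comp P (X \<boxtimes>\<^bsub>P\<^esub> D) (A \<boxtimes>\<^bsub>P\<^esub> B) B (Pr2 P A B) h = g"
      using X by (intro Pairing_ex1) (simp_all add: simps Prod_in_Obj)
    then show "\<exists>!h. h \<in> Hom ?K D (A \<boxtimes>\<^bsub>?K\<^esub> B)
        \<and> Comp ?K D (A \<boxtimes>\<^bsub>?K\<^esub> B) A (Pr1 ?K A B) h = f
        \<and> Comp ?K D (A \<boxtimes>\<^bsub>?K\<^esub> B) B (Pr2 ?K A B) h = g"
      using * by (simp add: simps comp_Pr cong: conj_cong)
  qed (use X in \<open>simp_all add: simps Terminal_in_Obj Terminal_ex1 Prod_in_Obj\<close>,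
       use X in \<open>simp_all add: kleisli_doctrine_def Prod_in_Obj Pr1_in_Hom Pr2_in_Hom Comp_in_Hom\<close>)
qed

lemma kleisli_is_doctrine:
  fixes P :: "('o, 'a, 'p) doctrine"
  assumes "doctrine P" and X: "X \<in> Obj P" and \<phi>: "\<phi> \<in> carrier (Fib P X)"
  shows "doctrine (kleisli_doctrine P X \<phi>)"
proof -
  interpret doctrine P by fact
  let ?K = "kleisli_doctrine P X \<phi>"
  let ?w = "\<lambda>A. Reindex P (X \<boxtimes>\<^bsub>P\<^esub> A) X (Pr1 P X A) \<phi>"
  let ?pair = "\<lambda>A B g. Pairing P (X \<boxtimes>\<^bsub>P\<^esub> A) X B (Pr1 P X A) g"
  interpret K: fp_category ?K
    by (rule kleisli_fp_category) (use assms in auto)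
  have Obj: "Obj ?K = Obj P" and Hom: "\<And>A B. Hom ?K A B = Hom P (X \<boxtimes>\<^bsub>P\<^esub> A) B"
    and Reindex: "\<And>A B g. Reindex ?K A B g = Reindex P (X \<boxtimes>\<^bsub>P\<^esub> A) (X \<boxtimes>\<^bsub>P\<^esub> B) (?pair A B g)"
    and carrier: "\<And>A. carrier (Fib ?K A)
      = {\<alpha> \<in> carrier (Fib P (X \<boxtimes>\<^bsub>P\<^esub> A)). \<alpha> \<sqsubseteq>\<^bsub>Fib P (X \<boxtimes>\<^bsub>P\<^esub> A)\<^esub> ?w A}"
    and le: "\<And>A \<alpha> \<beta>. \<alpha> \<sqsubseteq>\<^bsub>Fib ?K A\<^esub> \<beta> \<longleftrightarrow> \<alpha> \<sqsubseteq>\<^bsub>Fib P (X \<boxtimes>\<^bsub>P\<^esub> A)\<^esub> \<beta>"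
    by (simp_all add: kleisli_doctrine_def)
  have pair: "?pair A B g \<in> Hom P (X \<boxtimes>\<^bsub>P\<^esub> A) (X \<boxtimes>\<^bsub>P\<^esub> B)"
    if "A \<in> Obj P" "B \<in> Obj P" "g \<in> Hom P (X \<boxtimes>\<^bsub>P\<^esub> A) B" for A B g
    using that X by (simp add: Pairing_props Prod_in_Obj Pr1_in_Hom)
  have w: "?w A \<in> carrier (Fib P (X \<boxtimes>\<^bsub>P\<^esub> A))" if "A \<in> Obj P" for A
    using Reindex_closed[of "X \<boxtimes>\<^bsub>P\<^esub> A" X "Pr1 P X A"] X \<phi> that
    by (auto simp: Prod_in_Obj Pr1_in_Hom)
  have po: "partial_order (Fib ?K A)" if "A \<in> Obj P" for A
  proof -
    interpret F: partial_order "Fib P (X \<boxtimes>\<^bsub>P\<^esub> A)"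
      using Fib_partial_order X that Prod_in_Obj by blast
    show ?thesis
      by unfold_locales
        (auto simp: kleisli_doctrine_def F.eq_is_equal intro: F.le_antisym F.le_trans)
  qed
  have closed: "Reindex ?K A B g \<in> carrier (Fib ?K B) \<rightarrow> carrier (Fib ?K A)"
    if A: "A \<in> Obj P" and B: "B \<in> Obj P" and g: "g \<in> Hom P (X \<boxtimes>\<^bsub>P\<^esub> A) B" for A B g
  proof
    fix \<alpha> assume "\<alpha> \<in> carrier (Fib ?K B)"
    then have \<alpha>: "\<alpha> \<in> carrier (Fib P (X \<boxtimes>\<^bsub>P\<^esub> B))" "\<alpha> \<sqsubseteq>\<^bsub>Fib P (X \<boxtimes>\<^bsub>P\<^esub> B)\<^esub> ?w B"
      by (auto simp: carrier)
    have "?w A = Reindex P (X \<boxtimes>\<^bsub>P\<^esub> A) X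
        (Comp P (X \<boxtimes>\<^bsub>P\<^esub> A) (X \<boxtimes>\<^bsub>P\<^esub> B) X (Pr1 P X B) (?pair A B g)) \<phi>"
      using A B g X by (simp add: Pairing_props Prod_in_Obj Pr1_in_Hom)
    also have "\<dots> = Reindex P (X \<boxtimes>\<^bsub>P\<^esub> A) (X \<boxtimes>\<^bsub>P\<^esub> B) (?pair A B g) (?w B)"
      using A B g X \<phi> pair by (intro Reindex_Comp) (auto simp: Prod_in_Obj Pr1_in_Hom)
    finally have "Reindex P (X \<boxtimes>\<^bsub>P\<^esub> A) (X \<boxtimes>\<^bsub>P\<^esub> B) (?pair A B g) \<alpha> \<sqsubseteq>\<^bsub>Fib P (X \<boxtimes>\<^bsub>P\<^esub> A)\<^esub> ?w A"
      using use_iso2[OF Reindex_isotone[OF _ _ pair[OF A B g]] \<alpha>(1) w[OF B] \<alpha>(2)] A B X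
      by (simp add: Prod_in_Obj)
    moreover have "Reindex P (X \<boxtimes>\<^bsub>P\<^esub> A) (X \<boxtimes>\<^bsub>P\<^esub> B) (?pair A B g) \<alpha> \<in> carrier (Fib P (X \<boxtimes>\<^bsub>P\<^esub> A))"
      using Reindex_closed[OF _ _ pair[OF A B g]] \<alpha>(1) A B X by (auto simp: Prod_in_Obj)
    ultimately show "Reindex ?K A B g \<alpha> \<in> carrier (Fib ?K A)"
      by (simp add: carrier Reindex)
  qed
  show ?thesis
  proof (intro doctrine.intro doctrine_axioms.intro)
    fix A B f assume "A \<in> Obj ?K" "B \<in> Obj ?K" "f \<in> Hom ?K A B"
    then have *: "A \<in> Obj P" "B \<in> Obj P" "f \<in> Hom P (X \<boxtimes>\<^bsub>P\<^esub> A) B"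
      by (simp_all add: Obj Hom)
    show "Reindex ?K A B f \<in> carrier (Fib ?K B) \<rightarrow> carrier (Fib ?K A)"
      by (rule closed[OF *])
    show "isotone (Fib ?K B) (Fib ?K A) (Reindex ?K A B f)"
    proof (rule isotoneI)
      show "weak_partial_order (Fib ?K B)" "weak_partial_order (Fib ?K A)"
        using po * by (auto simp: partial_order_def)
      show "Reindex ?K A B f \<alpha> \<sqsubseteq>\<^bsub>Fib ?K A\<^esub> Reindex ?K A B f \<beta>"
        if "\<alpha> \<in> carrier (Fib ?K B)" "\<beta> \<in> carrier (Fib ?K B)" "\<alpha> \<sqsubseteq>\<^bsub>Fib ?K B\<^esub> \<beta>" for \<alpha> \<beta>
        using that use_iso2[OF Reindex_isotone[OF _ _ pair[OF *]], of \<alpha> \<beta>] * X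
        by (simp add: carrier le Reindex Prod_in_Obj)
    qed
  next
    fix A \<alpha> assume "A \<in> Obj ?K" "\<alpha> \<in> carrier (Fib ?K A)"
    then show "Reindex ?K A A (Id ?K A) \<alpha> = \<alpha>"
      using X by (simp add: kleisli_doctrine_def Pairing_Pr Reindex_Id Prod_in_Obj)
  next
    fix A B D f g \<alpha>
    assume "A \<in> Obj ?K" "B \<in> Obj ?K" "D \<in> Obj ?K" "f \<in> Hom ?K A B" "g \<in> Hom ?K B D"
      "\<alpha> \<in> carrier (Fib ?K D)"
    then have *: "A \<in> Obj P" "B \<in> Obj P" "D \<in> Obj P" "f \<in> Hom P (X \<boxtimes>\<^bsub>P\<^esub> A) B"
        "g \<in> Hom P (X \<boxtimes>\<^bsub>P\<^esub> B) D" "\<alpha> \<in> carrier (Fib P (X \<boxtimes>\<^bsub>P\<^esub> D))"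
      by (simp_all add: Obj Hom carrier)
    have "Comp P (X \<boxtimes>\<^bsub>P\<^esub> A) (X \<boxtimes>\<^bsub>P\<^esub> B) (X \<boxtimes>\<^bsub>P\<^esub> D) (?pair B D g) (?pair A B f)
        = ?pair A D (Comp P (X \<boxtimes>\<^bsub>P\<^esub> A) (X \<boxtimes>\<^bsub>P\<^esub> B) D g (?pair A B f))"
      using X * by (simp add: Pairing_Comp Pairing_props Prod_in_Obj Pr1_in_Hom)
    then show "Reindex ?K A D (Comp ?K A B D g f) \<alpha>
        = Reindex ?K A B f (Reindex ?K B D g \<alpha>)"
      using X * Reindex_Comp[of "X \<boxtimes>\<^bsub>P\<^esub> A" "X \<boxtimes>\<^bsub>P\<^esub> B" "X \<boxtimes>\<^bsub>P\<^esub> D" "?pair A B f" "?pair B D g" \<alpha>]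
      by (simp add: kleisli_doctrine_def pair Prod_in_Obj)
  qed (simp_all add: K.fp_category_axioms Obj po)
qed

end

theory Submission
  imports Defs
begin

text \<open>A predicate on \<open>X \<times> (A \<times> B)\<close> is, after reordering, a predicate on \<open>A \<times> (X \<times> B)\<close>, whose
  classifying arrow \<open>X \<times> B \<rightarrow> \<P>(A)\<close> is an arrow \<open>B \<leadsto> \<P>(A)\<close> of the Kleisli category. Hence \<open>\<P>(A)\<close>
  itself is a weak power object of \<open>A\<close> for the Kleisli doctrine, with membership predicate
  \<open>P(pr\<^sub>2)(\<in>\<^sub>A) \<and> P(pr\<^sub>1)(\<phi>)\<close>; the second conjunct is harmless as all predicates considered lie
  below \<open>P(pr\<^sub>1)(\<phi>)\<close>.\<close>

context fp_category
begin

lemma Comp_Prod_map_Pairing: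
  assumes "D \<in> Obj C" "A \<in> Obj C" "A' \<in> Obj C" "B \<in> Obj C" "B' \<in> Obj C"
    and "f \<in> Hom C A A'" "g \<in> Hom C B B'" "h \<in> Hom C D A" "k \<in> Hom C D B"
  shows "Comp C D (A \<boxtimes> B) (A' \<boxtimes> B') (Prod_map C A A' B B' f g) (Pairing C D A B h k)
          = Pairing C D A' B' (Comp C D A A' f h) (Comp C D B B' g k)"
  using assms
  by (simp add: Prod_map_def Pairing_Comp Comp_in_Hom Prod_in_Obj Pr1_in_Hom Pr2_in_Hom
      Pairing_props flip: Comp_assoc)

lemma Pairing_eta:
  assumes "D \<in> Obj C" "A \<in> Obj C" "B \<in> Obj C" "h \<in> Hom C D (A \<boxtimes> B)"
  shows "Pairing C D A B (Comp C D (A \<boxtimes> B) A (Pr1 C A B) h) (Comp C D (A \<boxtimes> B) B (Pr2 C A B) h) = h"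
  using Pairing_unique[OF assms refl refl] by simp

end

text \<open>Composing a Kleisli projection with \<open>h\<close> in the Kleisli category gives the
  ordinary projection composed with \<open>h\<close>, because the \<open>Pr2 P X\<close> inside it
  cancels the pairing with \<open>Pr1 P X\<close>. So the ordinary pairing satisfies the equations
  that determine the Kleisli one.\<close>

lemma kleisli_Pairing:
  fixes P :: "('o, 'a, 'p) doctrine"
  assumes "doctrine P" and "X \<in> Obj P" "D \<in> Obj P" "A \<in> Obj P" "B \<in> Obj P"
    and "f \<in> Hom P (X \<boxtimes>\<^bsub>P\<^esub> D) A" "g \<in> Hom P (X \<boxtimes>\<^bsub>P\<^esub> D) B"
  shows "Pairing (kleisli_doctrine P X \<phi>) D A B f g = Pairing P (X \<boxtimes>\<^bsub>P\<^esub> D) A B f g"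
proof -
  interpret doctrine P by fact
  let ?K = "kleisli_doctrine P X \<phi>"
  interpret K: fp_category ?K
    by (rule kleisli_fp_category) (use assms in auto)
  show ?thesis
    by (rule K.Pairing_unique[symmetric])
      (use assms in \<open>simp_all add: kleisli_doctrine_def Prod_in_Obj Pr1_in_Hom Pr2_in_Hom
        Pairing_props flip: Comp_assoc\<close>)
qed

text \<open>Translates the arrow occurring in the definition of weak power objects for the Kleisli
  doctrine into an arrow of \<open>P\<close>. The first component simplifies by the Kleisli unit
  law; the second is Kleisli composition unfolded.\<close>

lemma kleisli_Prod_map_Id:
  fixes P :: "('o, 'a, 'p) doctrine" and X :: 'o and \<phi> :: 'p
  assumes "doctrine P" and "X \<in> Obj P" "A \<in> Obj P" "B \<in> Obj P" "B' \<in> Obj P"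
    and "f \<in> Hom P (X \<boxtimes>\<^bsub>P\<^esub> B) B'"
  defines "K \<equiv> kleisli_doctrine P X \<phi>"
  defines "Q \<equiv> X \<boxtimes>\<^bsub>P\<^esub> (A \<boxtimes>\<^bsub>P\<^esub> B)"
  shows "Prod_map K A A B B' (Id K A) f
    = Pairing P Q A B' (Pr1 K A B)
        (Comp P Q (X \<boxtimes>\<^bsub>P\<^esub> B) B' f (Pairing P Q X B (Pr1 P X (A \<boxtimes>\<^bsub>P\<^esub> B)) (Pr2 K A B)))"
proof -
  interpret doctrine P by fact
  interpret K: fp_category K
    unfolding K_def by (rule kleisli_fp_category) (use assms in auto)
  have simps: "Obj K = Obj P" "Prod K = Prod P" "\<And>A B. Hom K A B = Hom P (X \<boxtimes>\<^bsub>P\<^esub> A) B"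
    by (simp_all add: K_def kleisli_doctrine_def)
  have Pr: "Pr1 K A B \<in> Hom P Q A" "Pr2 K A B \<in> Hom P Q B"
    using K.Pr1_in_Hom[of A B] K.Pr2_in_Hom[of A B] assms(2-5) by (simp_all add: simps Q_def)
  have "Comp K (A \<boxtimes>\<^bsub>P\<^esub> B) A A (Id K A) (Pr1 K A B) = Pr1 K A B"
    using K.Comp_Id_left[of "A \<boxtimes>\<^bsub>P\<^esub> B" A "Pr1 K A B"] Pr assms(2-5)
    by (simp add: simps Q_def Prod_in_Obj)
  moreover have "Comp K (A \<boxtimes>\<^bsub>P\<^esub> B) B B' f (Pr2 K A B)
      = Comp P Q (X \<boxtimes>\<^bsub>P\<^esub> B) B' f (Pairing P Q X B (Pr1 P X (A \<boxtimes>\<^bsub>P\<^esub> B)) (Pr2 K A B))"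
    by (simp add: K_def kleisli_doctrine_def Q_def)
  moreover have "Comp P Q (X \<boxtimes>\<^bsub>P\<^esub> B) B' f (Pairing P Q X B (Pr1 P X (A \<boxtimes>\<^bsub>P\<^esub> B)) (Pr2 K A B))
      \<in> Hom P Q B'"
    using assms(2-6) Pr unfolding Q_def by (intro Comp_in_Hom Pairing_props) (simp_all add: Prod_in_Obj Pr1_in_Hom)
  ultimately show ?thesis
    using assms(1-5) Pr kleisli_Pairing[of P X "A \<boxtimes>\<^bsub>P\<^esub> B" A B' "Pr1 K A B" _ \<phi>]
    by (simp add: Prod_map_def simps Q_def Prod_in_Obj flip: K_def)
qed

theorem proposition5p16:
  fixes P :: "('o, 'a, 'p) doctrine" and X :: 'o and \<phi> :: 'p
  assumes "primary_doctrine P"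
    and "X \<in> Obj P" and "\<phi> \<in> carrier (Fib P X)"
    and "has_weak_power_objects P"
  shows "has_weak_power_objects (kleisli_doctrine P X \<phi>)"
proof -
  interpret primary_doctrine P by fact
  note X = assms(2) and \<phi> = assms(3)
  define K where "K = kleisli_doctrine P X \<phi>"
  have simps: "Obj K = Obj P" "Prod K = Prod P" "\<And>A B. Hom K A B = Hom P (X \<boxtimes>\<^bsub>P\<^esub> A) B"
    by (simp_all add: K_def kleisli_doctrine_def)
  have Reindex_in: "Reindex P A B f \<alpha> \<in> carrier (Fib P A)"
    if "A \<in> Obj P" "B \<in> Obj P" "f \<in> Hom P A B" "\<alpha> \<in> carrier (Fib P B)" for A B f \<alpha>
    using Reindex_closed[OF that(1-3)] that(4) by auto
  have carrier: "\<alpha> \<in> carrier (Fib K A) \<longleftrightarrow> \<alpha> \<in> carrier (Fib P (X \<boxtimes>\<^bsub>P\<^esub> A)) \<and>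
      \<alpha> \<sqsubseteq>\<^bsub>Fib P (X \<boxtimes>\<^bsub>P\<^esub> A)\<^esub> Reindex P (X \<boxtimes>\<^bsub>P\<^esub> A) X (Pr1 P X A) \<phi>" for A \<alpha>
    by (simp add: K_def kleisli_doctrine_def)
  have "\<exists>PA \<in> Obj P. \<exists>mem \<in> carrier (Fib K (A \<boxtimes>\<^bsub>P\<^esub> PA)).
      \<forall>B \<in> Obj P. \<forall>\<psi> \<in> carrier (Fib K (A \<boxtimes>\<^bsub>P\<^esub> B)). \<exists>f \<in> Hom P (X \<boxtimes>\<^bsub>P\<^esub> B) PA.
        \<psi> = Reindex K (A \<boxtimes>\<^bsub>P\<^esub> B) (A \<boxtimes>\<^bsub>P\<^esub> PA) (Prod_map K A A B PA (Id K A) f) mem"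
    if A: "A \<in> Obj P" for A
  proof -
    obtain PA mem where PA: "PA \<in> Obj P" and mem: "mem \<in> carrier (Fib P (A \<boxtimes>\<^bsub>P\<^esub> PA))"
      and classify: "\<And>B \<psi>. B \<in> Obj P \<Longrightarrow> \<psi> \<in> carrier (Fib P (A \<boxtimes>\<^bsub>P\<^esub> B)) \<Longrightarrow> \<exists>f \<in> Hom P B PA.
        \<psi> = Reindex P (A \<boxtimes>\<^bsub>P\<^esub> B) (A \<boxtimes>\<^bsub>P\<^esub> PA) (Prod_map P A A B PA (Id P A) f) mem"
      using assms(4) A unfolding has_weak_power_objects_def by metis
    define S where "S = X \<boxtimes>\<^bsub>P\<^esub> (A \<boxtimes>\<^bsub>P\<^esub> PA)"
    define p where "p = Pr1 P X (A \<boxtimes>\<^bsub>P\<^esub> PA)"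
    define q where "q = Pr2 P X (A \<boxtimes>\<^bsub>P\<^esub> PA)"
    \<comment> \<open>The meet with \<open>Reindex P S X p \<phi>\<close> is what places the
      pulled-back membership predicate in the Kleisli fibre.\<close>
    define mem' where "mem' = Reindex P S (A \<boxtimes>\<^bsub>P\<^esub> PA) q mem \<sqinter>\<^bsub>Fib P S\<^esub> Reindex P S X p \<phi>"
    have APA: "A \<boxtimes>\<^bsub>P\<^esub> PA \<in> Obj P" and S: "S \<in> Obj P"
      using A PA X by (simp_all add: S_def Prod_in_Obj)
    have p: "p \<in> Hom P S X" and q: "q \<in> Hom P S (A \<boxtimes>\<^bsub>P\<^esub> PA)"
      using APA X by (simp_all add: p_def q_def S_def Pr1_in_Hom Pr2_in_Hom)
    have r1: "Reindex P S (A \<boxtimes>\<^bsub>P\<^esub> PA) q mem \<in> carrier (Fib P S)"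
      and r2: "Reindex P S X p \<phi> \<in> carrier (Fib P S)"
      using Reindex_in S APA X p q mem \<phi> by blast+
    interpret FS: lower_semilattice "Fib P S"
      using Fib_meet S .
    have mem': "mem' \<in> carrier (Fib K (A \<boxtimes>\<^bsub>P\<^esub> PA))"
      using FS.meet_closed[OF r1 r2] FS.meet_right[OF r1 r2]
      unfolding carrier mem'_def by (simp add: S_def p_def)
    have "\<exists>f \<in> Hom P (X \<boxtimes>\<^bsub>P\<^esub> B) PA.
        \<psi> = Reindex K (A \<boxtimes>\<^bsub>P\<^esub> B) (A \<boxtimes>\<^bsub>P\<^esub> PA) (Prod_map K A A B PA (Id K A) f) mem'"
      if B: "B \<in> Obj P" and "\<psi> \<in> carrier (Fib K (A \<boxtimes>\<^bsub>P\<^esub> B))" for B \<psi>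
    proof -
      define AB where "AB = A \<boxtimes>\<^bsub>P\<^esub> B"
      define XB where "XB = X \<boxtimes>\<^bsub>P\<^esub> B"
      define Q where "Q = X \<boxtimes>\<^bsub>P\<^esub> AB"
      define T where "T = A \<boxtimes>\<^bsub>P\<^esub> XB"
      have Obj: "AB \<in> Obj P" "XB \<in> Obj P" "Q \<in> Obj P" "T \<in> Obj P"
        using A B X by (simp_all add: AB_def XB_def Q_def T_def Prod_in_Obj)
      \<comment> \<open>The three coordinates of X \<times> (A \<times> B); \<open>a\<close> and
        \<open>b\<close> are at the same time the Kleisli projections of A \<times> B.\<close>
      define x where "x = Pr1 P X AB"
      define a where "a = Comp P Q AB A (Pr1 P A B) (Pr2 P X AB)"
      define b where "b = Comp P Q AB B (Pr2 P A B) (Pr2 P X AB)"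
      have x: "x \<in> Hom P Q X" and Pr2_Q: "Pr2 P X AB \<in> Hom P Q AB"
        using X Obj by (simp_all add: x_def Q_def Pr1_in_Hom Pr2_in_Hom)
      have Pr_AB: "Pr1 P A B \<in> Hom P AB A" "Pr2 P A B \<in> Hom P AB B"
        using A B by (simp_all add: AB_def Pr1_in_Hom Pr2_in_Hom)
      have a: "a \<in> Hom P Q A" and b: "b \<in> Hom P Q B"
        using Comp_in_Hom Pr_AB Pr2_Q A B Obj by (simp_all add: a_def b_def)
      have K_Pr: "Pr1 K A B = a" "Pr2 K A B = b"
        by (simp_all add: K_def kleisli_doctrine_def a_def b_def AB_def Q_def)
      define xb where "xb = Pairing P Q X B x b"
      have xb: "xb \<in> Hom P Q XB"
        and xb_x: "Comp P Q XB X (Pr1 P X B) xb = x" and xb_b: "Comp P Q XB B (Pr2 P X B) xb = b"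
        unfolding xb_def XB_def using Pairing_props[OF Obj(3) X B x b] by auto
      \<comment> \<open>The reordering X \<times> (A \<times> B) \<rightarrow> A \<times> (X
        \<times> B), given on coordinates by (x, (a, b)) \<mapsto> (a, (x, b)).\<close>
      define t where "t = Pairing P Q A XB a xb"
      have t: "t \<in> Hom P Q T"
        and t_a: "Comp P Q T A (Pr1 P A XB) t = a" and t_xb: "Comp P Q T XB (Pr2 P A XB) t = xb"
        unfolding t_def T_def using Pairing_props[OF Obj(3) A Obj(2) a xb] by auto
      \<comment> \<open>The coordinates of A \<times> (X \<times> B) are now reassembled into the
        reordering \<open>s\<close> in the opposite direction.\<close>
      define x' where "x' = Comp P T XB X (Pr1 P X B) (Pr2 P A XB)"
      define b' where "b' = Comp P T XB B (Pr2 P X B) (Pr2 P A XB)"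
      define ab' where "ab' = Pairing P T A B (Pr1 P A XB) b'"
      define s where "s = Pairing P T X AB x' ab'"
      have Pr_T: "Pr1 P A XB \<in> Hom P T A" "Pr2 P A XB \<in> Hom P T XB"
        using A Obj by (simp_all add: T_def Pr1_in_Hom Pr2_in_Hom)
      have Pr_XB: "Pr1 P X B \<in> Hom P XB X" "Pr2 P X B \<in> Hom P XB B"
        using X B by (simp_all add: XB_def Pr1_in_Hom Pr2_in_Hom)
      have x': "x' \<in> Hom P T X" and b': "b' \<in> Hom P T B"
        using Comp_in_Hom Pr_T Pr_XB X B Obj by (simp_all add: x'_def b'_def)
      have ab': "ab' \<in> Hom P T AB"
        unfolding ab'_def AB_def using Pairing_props(1)[OF Obj(4) A B Pr_T(1) b'] .
      have s: "s \<in> Hom P T Q"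
        unfolding s_def Q_def using Pairing_props(1)[OF Obj(4) X Obj(1) x' ab'] .
      have x't: "Comp P Q T X x' t = x"
        using Comp_assoc[OF Obj(3,4,2) X t Pr_T(2) Pr_XB(1)] by (simp add: x'_def t_xb xb_x)
      have b't: "Comp P Q T B b' t = b"
        using Comp_assoc[OF Obj(3,4,2) B t Pr_T(2) Pr_XB(2)] by (simp add: b'_def t_xb xb_b)
      \<comment> \<open>The composite is the pairing of \<open>a\<close> and \<open>b\<close>, which
        are the two components of \<open>Pr2 P X AB\<close>; hence \<open>Pairing_eta\<close>
        applies.\<close>
      have ab't: "Comp P Q T AB ab' t = Pr2 P X AB"
        using Pairing_Comp[OF Obj(3,4) A B Pr_T(1) b' t] Pairing_eta[OF Obj(3) A B] Pr2_Q
        by (simp add: ab'_def t_a b't a_def b_def AB_def)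
      have st: "Comp P Q T Q s t = Id P Q"
        using Pairing_Comp[OF Obj(3,4) X Obj(1) x' ab' t] Pairing_Pr[OF X Obj(1)]
        by (simp add: s_def x't ab't flip: Q_def x_def)
      have \<psi>: "\<psi> \<in> carrier (Fib P Q)" and \<psi>_le: "\<psi> \<sqsubseteq>\<^bsub>Fib P Q\<^esub> Reindex P Q X x \<phi>"
        using that(2) by (simp_all add: carrier Q_def AB_def x_def)
      \<comment> \<open>The predicate classified is \<psi> moved to A \<times> (X \<times> B) along
        \<open>s\<close>. Its classifying arrow therefore starts at X \<times> B, so it is a Kleisli
        arrow from B.\<close>
      obtain f where f: "f \<in> Hom P XB PA" and \<psi>_f:
          "Reindex P T Q s \<psi> = Reindex P T (A \<boxtimes>\<^bsub>P\<^esub> PA) (Prod_map P A A XB PA (Id P A) f) mem"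
        using classify[OF Obj(2), of "Reindex P T Q s \<psi>"] Reindex_in[OF Obj(4,3) s \<psi>]
        by (auto simp: T_def)
      \<comment> \<open>The Kleisli product of the identity and \<open>f\<close>, in the form
        provided by \<open>kleisli_Prod_map_Id\<close>.\<close>
      define m where "m = Pairing P Q A PA a (Comp P Q XB PA f xb)"
      have m: "m \<in> Hom P Q (A \<boxtimes>\<^bsub>P\<^esub> PA)"
        unfolding m_def using Pairing_props(1)[OF Obj(3) A PA a]
          Comp_in_Hom[OF Obj(3,2) PA xb f] by simp
      have m_K: "Prod_map K A A B PA (Id K A) f = m"
        using kleisli_Prod_map_Id[of P X A B PA f \<phi>] doctrine_axioms X A B PA f
        by (simp add: m_def K_Pr xb_def x_def XB_def Q_def AB_def flip: K_def)
      have prod: "Prod_map P A A XB PA (Id P A) f \<in> Hom P T (A \<boxtimes>\<^bsub>P\<^esub> PA)"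
        unfolding Prod_map_def
        using A PA Obj f Pr_T by (simp flip: T_def add: Pairing_props Comp_in_Hom Id_in_Hom)
      \<comment> \<open>The Kleisli product map is the product map of \<open>P\<close> preceded by
        the reordering \<open>t\<close>.\<close>
      have m_t: "Comp P Q T (A \<boxtimes>\<^bsub>P\<^esub> PA) (Prod_map P A A XB PA (Id P A) f) t = m"
        using Comp_Prod_map_Pairing[OF Obj(3) A A Obj(2) PA Id_in_Hom[OF A] f a xb]
          Comp_Id_left[OF Obj(3) A a]
        by (simp add: t_def T_def m_def)
      \<comment> \<open>Reindexing \<open>mem\<close> along \<open>m\<close> first yields \<psi>
        reindexed along \<open>s\<close>, by the choice of \<open>f\<close>, and then reindexes this
        along \<open>t\<close>; as \<open>s\<close> after \<open>t\<close> is the identity, \<psi>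
        comes back.\<close>
      have \<psi>_m: "Reindex P Q (A \<boxtimes>\<^bsub>P\<^esub> PA) m mem = \<psi>"
        using Reindex_Comp[OF Obj(3,4) APA t prod mem] Reindex_Comp[OF Obj(3,4,3) t s \<psi>]
          Reindex_Id[OF Obj(3) \<psi>] \<psi>_f
        by (simp add: m_t st)
      \<comment> \<open>Kleisli reindexing along \<open>m\<close> is by definition reindexing in
        \<open>P\<close> along this pairing.\<close>
      define n where "n = Pairing P Q X (A \<boxtimes>\<^bsub>P\<^esub> PA) x m"
      have n: "n \<in> Hom P Q S"
        and p_n: "Comp P Q S X p n = x" and q_n: "Comp P Q S (A \<boxtimes>\<^bsub>P\<^esub> PA) q n = m"
        unfolding n_def S_def p_def q_def using Pairing_props[OF Obj(3) X APA x m] by auto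
      have "Reindex K (A \<boxtimes>\<^bsub>P\<^esub> B) (A \<boxtimes>\<^bsub>P\<^esub> PA) m mem' = Reindex P Q S n mem'"
        by (simp add: K_def kleisli_doctrine_def Q_def AB_def S_def n_def x_def)
      \<comment> \<open>Reindexing preserves the meet in \<open>mem'\<close>; the first conjunct is
        then reindexed along \<open>m\<close> and the second along \<open>x\<close>.\<close>
      also have "\<dots> = \<psi> \<sqinter>\<^bsub>Fib P Q\<^esub> Reindex P Q X x \<phi>"
        unfolding mem'_def Reindex_meet[OF Obj(3) S n r1 r2]
        using Reindex_Comp[OF Obj(3) S APA n q mem] Reindex_Comp[OF Obj(3) S X n p \<phi>]
        by (simp add: p_n q_n \<psi>_m)
      \<comment> \<open>The meet is absorbed since \<psi>, lying in the Kleisli fibre, is below the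
        second conjunct.\<close>
      also have "\<dots> = \<psi>"
      proof -
        interpret FQ: lower_semilattice "Fib P Q"
          using Fib_meet Obj(3) .
        have w: "Reindex P Q X x \<phi> \<in> carrier (Fib P Q)"
          using Reindex_in[OF Obj(3) X x \<phi>] .
        show ?thesis
          using FQ.meet_left[OF \<psi> w] FQ.meet_le[OF FQ.le_refl[OF \<psi>] \<psi>_le \<psi> w \<psi>] \<psi> w
          by (intro FQ.le_antisym) auto
      qed
      finally show ?thesis
        using f m_K by (metis XB_def)
    qed
    then show ?thesis
      using PA mem' by blast
  qed
  then show ?thesis
    unfolding has_weak_power_objects_def K_def[symmetric] simps by blast
qed

end
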